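(* Let $G$ be an Abelian group of order $n$, let $m\ge 2$, let $K=(k_1,\dots,k_m)$ be a tuple of positive integers, $a=\sum_{i=1}^m k_i$, $\widetilde{k}=\mathrm{lcm}(k_1,\dots,k_m)$, let $\lambda$ be a positive integer and let $\rho=\frac{\lambda}{\widetilde{k}m}$. There exists a weak $(n,m,a,\rho)$-AMD code $(S,G,\mathcal{A},E_u)$ with $S=\{s_1,\dots,s_m\}$ and $(|A_{s_1}|,\dots,|A_{s_m}|)=K$ if and only if there exists an $(n,m,K,a,\lambda)$-BSWEDF over $G$.
   Context: All groups are written additively with identity $0$. Weak AMD code: let $S$ be a set of $m$ source messages, $G$ an Abelian group of order $n$, and $\mathcal{A}=\{A_s : s\in S\}$ a family of pairwise disjoint nonempty subsets of $G$ ($A_s$ is the set of valid encodings of $s$). A source $s\in S$ is chosen uniformly at random, and $E_u$ encodes $s$ as a uniformly random $g\in A_s$. The adversary, with no knowledge of $s$ or $g$, chooses $\Delta\in G\setminus\{0\}$ and wins if $g+\Delta\in A_{s'}$ for some $s'\neq s$. Let $\rho_\Delta$ be the probability that the adversary wins with $\Delta$, i.e. $\rho_\Delta=\frac1m\sum_{s\in S}\frac{1}{|A_s|}\,|\{g\in A_s : g+\Delta\in\bigcup_{s'\ne s}A_{s'}\}|$. Then $(S,G,\mathcal{A},E_u)$ is a weak $(n,m,a,\rho)$-AMD code, where $a=\sum_{s\in S}|A_s|$ and $\rho=\max\{\rho_\Delta : \Delta\in G\setminus\{0\}\}$. BSWEDF: for multi-sets $B_1,B_2$ of elements of $G$, $D(B_1,B_2)$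 is the multi-set $\{x-y : x\in B_1,\ y\in B_2\}$; for a positive integer $k$ and a multi-set $B$, $k\boxtimes B$ is the multi-set in which each element of $B$ is repeated $k$ times; unions are multi-set unions (multiplicities add). Let $\mathcal{B}=\{B_i : 1\le i\le m\}$ be a family of pairwise disjoint nonempty subsets of $G$, $k_i=|B_i|$, $K=(k_1,\dots,k_m)$, $a=\sum_i k_i$, $\widetilde{k}=\mathrm{lcm}(k_1,\dots,k_m)$, and $\widetilde{B}_i=\frac{\widetilde{k}}{k_i}\boxtimes B_i$. Then $\mathcal{B}$ is an $(n,m,K,a,\lambda)$-bounded standard weighted external difference family (BSWEDF) over $G$ if $\lambda$ is the smallest positive integer such that $\bigcup_{1\le i\ne j\le m}D(B_i,\widetilde{B}_j)\subseteq\lambda\boxtimes(G\setminus\{0\})$. *)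

theory Defs
  imports
    "HOL-Probability.Probability"
    "HOL-Library.Infinite_Typeclass"
begin

text \<open>
  The finite Abelian group \<open>G\<close> is the universe of a type of class
  \<^class>\<open>ab_group_add\<close> and \<^class>\<open>finite\<close>; its order is the cardinality of that type.
  \<^const>\<open>pmf_of_set\<close> is unspecified on empty and on infinite sets, and \<^const>\<open>Max\<close> on the
  empty set; neither case occurs for \<open>m \<ge> 2\<close>, since the trivial group has no two disjoint
  nonempty subsets.
\<close>

definition E_u :: "('s \<Rightarrow> 'g set) \<Rightarrow> 's \<Rightarrow> 'g pmf" where
  "E_u A s = pmf_of_set (A s)"

definition source_encoding_pmf :: "'s set \<Rightarrow> ('s \<Rightarrow> 'g set) \<Rightarrow> ('s \<times> 'g) pmf" where
  "source_encoding_pmf S A =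
     bind_pmf (pmf_of_set S) (\<lambda>s. bind_pmf (E_u A s) (\<lambda>g. return_pmf (s, g)))"

definition adversary_success ::
    "'s set \<Rightarrow> ('s \<Rightarrow> 'g set) \<Rightarrow> 'g::{finite, ab_group_add} \<Rightarrow> real" where
  "adversary_success S A \<Delta> =
     measure_pmf.prob (source_encoding_pmf S A)
       {(s, g). \<exists>s'\<in>S. s' \<noteq> s \<and> g + \<Delta> \<in> A s'}"

lemma adversary_success_eq:
  fixes A :: "'s \<Rightarrow> 'g::{finite, ab_group_add} set"
  assumes S: "finite S" "S \<noteq> {}" and A: "\<And>s. s \<in> S \<Longrightarrow> A s \<noteq> {}"
  shows "adversary_success S A \<Delta> =
    1 / real (card S) *
      (\<Sum>s\<in>S. 1 / real (card (A s)) * real (card {g \<in> A s. g + \<Delta> \<in> (\<Union>s'\<in>S - {s}. A s')}))"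
proof -
  let ?W = "{(s, g). \<exists>s'\<in>S. s' \<noteq> s \<and> g + \<Delta> \<in> A s'}"
  have enc: "measure_pmf.prob (bind_pmf (E_u A s) (\<lambda>g. return_pmf (s, g))) ?W =
      1 / real (card (A s)) * real (card {g \<in> A s. g + \<Delta> \<in> (\<Union>s'\<in>S - {s}. A s')})"
    if "s \<in> S" for s
  proof -
    have "A s \<inter> Pair s -` ?W = {g \<in> A s. g + \<Delta> \<in> (\<Union>s'\<in>S - {s}. A s')}"
      by auto
    then show ?thesis
      using A[OF that]
      by (simp add: E_u_def map_pmf_def[symmetric] measure_pmf_of_set)
  qed
  have "adversary_success S A \<Delta> =
      (\<integral>s. measure_pmf.prob (bind_pmf (E_u A s) (\<lambda>g. return_pmf (s, g))) ?W \<partial>pmf_of_set S)"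
    unfolding adversary_success_def source_encoding_pmf_def
    by (subst measure_pmf_bind, subst measure_pmf.measure_bind[where N = "count_space UNIV"])
      (auto simp: measure_pmf_in_subprob_algebra)
  then show ?thesis
    using S by (simp add: integral_pmf_of_set enc)
qed

definition weak_AMD_code ::
    "nat \<Rightarrow> nat \<Rightarrow> nat \<Rightarrow> real \<Rightarrow> 's set \<Rightarrow> ('s \<Rightarrow> 'g::{finite, ab_group_add} set) \<Rightarrow> bool" where
  "weak_AMD_code n m a \<rho> S A \<longleftrightarrow>
     CARD('g) = n \<and>
     finite S \<and> card S = m \<and>
     (\<forall>s\<in>S. A s \<noteq> {}) \<and> disjoint_family_on A S \<and>
     a = (\<Sum>s\<in>S. card (A s)) \<and>
     \<rho> = Max (adversary_success S A ` (UNIV - {0}))"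

definition diff_mset :: "'g::ab_group_add multiset \<Rightarrow> 'g multiset \<Rightarrow> 'g multiset" where
  "diff_mset B\<^sub>1 B\<^sub>2 = (\<Sum>x\<in>#B\<^sub>1. {#x - y. y \<in># B\<^sub>2#})"

definition weighted_block :: "nat \<Rightarrow> (nat \<Rightarrow> 'g set) \<Rightarrow> nat \<Rightarrow> 'g multiset" where
  "weighted_block m B i =
     repeat_mset (Lcm ((\<lambda>j. card (B j)) ` {1..m}) div card (B i)) (mset_set (B i))"

definition external_differences ::
    "nat \<Rightarrow> (nat \<Rightarrow> 'g::ab_group_add set) \<Rightarrow> 'g multiset" where
  "external_differences m B =
     (\<Sum>(i, j) \<in> {(i, j). i \<in> {1..m} \<and> j \<in> {1..m} \<and> i \<noteq> j}.
        diff_mset (mset_set (B i)) (weighted_block m B j))"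

text \<open>
  Families and tuples indexed by \<open>1, \<dots>, m\<close> are functions on \<^typ>\<open>nat\<close> whose values outside
  \<open>{1..m}\<close> are irrelevant.
\<close>

definition BSWEDF ::
    "nat \<Rightarrow> nat \<Rightarrow> (nat \<Rightarrow> nat) \<Rightarrow> nat \<Rightarrow> nat \<Rightarrow>
     (nat \<Rightarrow> 'g::{finite, ab_group_add} set) \<Rightarrow> bool" where
  "BSWEDF n m K a lam B \<longleftrightarrow>
     CARD('g) = n \<and>
     (\<forall>i\<in>{1..m}. B i \<noteq> {}) \<and> disjoint_family_on B {1..m} \<and>
     (\<forall>i\<in>{1..m}. card (B i) = K i) \<and>
     a = (\<Sum>i=1..m. K i) \<and>
     0 < lam \<and>
     external_differences m B \<subseteq># repeat_mset lam (mset_set (UNIV - {0})) \<and>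
     (\<forall>l>0. external_differences m B \<subseteq># repeat_mset l (mset_set (UNIV - {0})) \<longrightarrow> lam \<le> l)"

end

theory Submission imports Defs begin

text \<open>
  Every \<open>\<Delta>\<close> occurs in the multiset of weighted external differences exactly
  \<open>lcm (k\<^sub>1, \<dots>, k\<^sub>m) \<cdot> m \<cdot> \<rho>\<^sub>\<Delta>\<close> times: the weight \<open>1 / \<bar>A\<^sub>s\<bar>\<close> of an encoding of \<open>s\<close>, scaled
  by the least common multiple, is the multiplicity of that element in \<open>B\<^sub>s\<close> after weighting.
  Hence the least bound on the multiplicities is \<open>lcm (k\<^sub>1, \<dots>, k\<^sub>m) \<cdot> m \<cdot> \<rho>\<close>. For \<open>m \<ge> 2\<close> at least
  one nonzero external difference occurs, so requiring \<open>\<lambda>\<close> to be positive excludes nothing.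
\<close>

text \<open>An equation x - y = d is settled by y alone, since x = y + d. Counting by y rather than
  by x matches the game: y is the encoding and d is the adversary's shift.\<close>

lemma count_diff_mset_repeat_mset:
  fixes X Y :: "'g::ab_group_add set"
  assumes "finite X" "finite Y"
  shows "count (diff_mset (mset_set X) (repeat_mset c (mset_set Y))) d =
    c * card {y \<in> Y. y + d \<in> X}"
proof -
  have "count (image_mset ((-) x) M) d = count M (x - d)" for x and M :: "'g multiset"
    by (induction M) auto
  then have "count (diff_mset (mset_set X) (repeat_mset c (mset_set Y))) d =
      (\<Sum>x\<in>X. c * (if x - d \<in> Y then 1 else 0))"
    using assms by (simp add: diff_mset_def sum_unfold_sum_mset[symmetric] count_sum
        count_mset_set')
  also have "\<dots> = c * card {x \<in> X. x - d \<in> Y}"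
    using assms by (simp add: sum_distrib_left[symmetric] sum.If_cases Int_def)
  also have "card {x \<in> X. x - d \<in> Y} = card {y \<in> Y. y + d \<in> X}"
    by (rule bij_betw_same_card[of "\<lambda>x. x - d"], rule bij_betwI[where g = "\<lambda>y. y + d"]) auto
  finally show ?thesis .
qed

text \<open>Group the pairs (i, j) by the weighted index j. For fixed j, disjointness lets g + d lie
  in at most one other block, so the counts over i add up to the count for the union.\<close>

lemma count_external_differences:
  fixes B :: "nat \<Rightarrow> 'g::{finite, ab_group_add} set"
  assumes disj: "disjoint_family_on B {1..m}"
  shows "count (external_differences m B) d =
    (\<Sum>j=1..m. Lcm ((\<lambda>j. card (B j)) ` {1..m}) div card (B j) *
       card {g \<in> B j. g + d \<in> (\<Union>i\<in>{1..m} - {j}. B i)})"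
proof -
  let ?w = "\<lambda>j. Lcm ((\<lambda>j. card (B j)) ` {1..m}) div card (B j)"
  let ?P = "{(i, j). i \<in> {1..m} \<and> j \<in> {1..m} \<and> i \<noteq> j}"
  have "count (external_differences m B) d =
      (\<Sum>(i, j)\<in>?P. ?w j * card {y \<in> B j. y + d \<in> B i})"
    unfolding external_differences_def weighted_block_def count_sum
    by (intro sum.cong refl) (auto simp: count_diff_mset_repeat_mset)
  also have "\<dots> = (\<Sum>(j, i)\<in>(SIGMA j:{1..m}. {1..m} - {j}). ?w j * card {y \<in> B j. y + d \<in> B i})"
    by (rule sum.reindex_bij_witness[of _ prod.swap prod.swap]) auto
  also have "\<dots> = (\<Sum>j=1..m. \<Sum>i\<in>{1..m} - {j}. ?w j * card {y \<in> B j. y + d \<in> B i})"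
    by (simp add: sum.Sigma)
  also have "\<dots> = (\<Sum>j=1..m. ?w j * card {g \<in> B j. g + d \<in> (\<Union>i\<in>{1..m} - {j}. B i)})"
  proof (rule sum.cong[OF refl])
    fix j
    have "{g \<in> B j. g + d \<in> (\<Union>i\<in>{1..m} - {j}. B i)} =
        (\<Union>i\<in>{1..m} - {j}. {y \<in> B j. y + d \<in> B i})"
      by auto
    also have "card \<dots> = (\<Sum>i\<in>{1..m} - {j}. card {y \<in> B j. y + d \<in> B i})"
      using disj by (intro card_UN_disjoint) (auto simp: disjoint_family_on_def)
    finally show "(\<Sum>i\<in>{1..m} - {j}. ?w j * card {y \<in> B j. y + d \<in> B i}) =
        ?w j * card {g \<in> B j. g + d \<in> (\<Union>i\<in>{1..m} - {j}. B i)}"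
      by (simp add: sum_distrib_left)
  qed
  finally show ?thesis .
qed

text \<open>Each block size divides the lcm, so the natural-number quotient is exact and becomes
  real division. The lcm then factors out of the sum, and m cancels the uniform choice of the
  source.\<close>

lemma count_external_differences_eq_adversary_success:
  fixes B :: "nat \<Rightarrow> 'g::{finite, ab_group_add} set"
  assumes disj: "disjoint_family_on B {1..m}" and ne: "\<And>i. i \<in> {1..m} \<Longrightarrow> B i \<noteq> {}"
    and m: "m \<ge> 1"
  shows "real (count (external_differences m B) d) =
    real (Lcm ((\<lambda>j. card (B j)) ` {1..m})) * real m * adversary_success {1..m} B d"
proof -
  have "real (Lcm ((\<lambda>j. card (B j)) ` {1..m}) div card (B j)) =
      real (Lcm ((\<lambda>j. card (B j)) ` {1..m})) / real (card (B j))" if "j \<in> {1..m}" for j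
    using that by (intro real_of_nat_div dvd_Lcm) auto
  then show ?thesis
    using m
    by (subst adversary_success_eq)
      (auto simp: count_external_differences[OF disj] ne sum_distrib_left)
qed

text \<open>The names of the sources do not affect the game. This carries a code over an arbitrary
  source type to the index set {1..m} used for difference families.\<close>

lemma adversary_success_reindex:
  fixes A :: "'s \<Rightarrow> 'g::{finite, ab_group_add} set"
  assumes s: "bij_betw s I S" and I: "finite I" "I \<noteq> {}" and ne: "\<And>i. i \<in> I \<Longrightarrow> A (s i) \<noteq> {}"
  shows "adversary_success S A d = adversary_success I (A \<circ> s) d"
proof -
  have S: "S = s ` I" and inj: "inj_on s I"
    using s by (auto simp: bij_betw_def)
  have "s ` I - {s i} = s ` (I - {i})" if "i \<in> I" for i
    using that inj by (auto simp: inj_on_def)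
  moreover have "adversary_success (s ` I) A d =
    1 / real (card I) * (\<Sum>i\<in>I. 1 / real (card (A (s i))) *
      real (card {g \<in> A (s i). g + d \<in> (\<Union>s'\<in>s ` I - {s i}. A s')}))"
    using I ne by (subst adversary_success_eq) (auto simp: card_image[OF inj] sum.reindex[OF inj])
  ultimately show ?thesis
    using I ne by (subst (2) adversary_success_eq) (auto simp: S)
qed

lemma weak_AMD_code_reindex:
  fixes A :: "'s \<Rightarrow> 'g::{finite, ab_group_add} set"
  assumes s: "bij_betw s I S" and I: "finite I" "I \<noteq> {}"
  shows "weak_AMD_code n m a \<rho> S A \<longleftrightarrow> weak_AMD_code n m a \<rho> I (A \<circ> s)"
proof -
  have S: "S = s ` I" and inj: "inj_on s I"
    using s by (auto simp: bij_betw_def)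
  have "disjoint_family_on A S \<longleftrightarrow> disjoint_family_on (A \<circ> s) I"
    using inj by (simp add: S disjoint_family_on_def inj_on_eq_iff)
  \<comment> \<open>\<open>pmf_of_set\<close> is unspecified on an empty set. Since
    \<open>weak_AMD_code\<close> itself demands nonempty encoding sets, equality under this
    condition suffices.\<close>
  moreover have "adversary_success S A = adversary_success I (A \<circ> s)"
    if "\<forall>x\<in>S. A x \<noteq> {}"
    using that by (intro ext adversary_success_reindex[OF s I]) (auto simp: S)
  ultimately show ?thesis
    using I by (auto simp: weak_AMD_code_def S card_image[OF inj] sum.reindex[OF inj])
qed

text \<open>The equivalence holds for each single family, so the existence theorem only has to
  rename sources.\<close>

lemma weak_AMD_code_iff_BSWEDF:
  fixes B :: "nat \<Rightarrow> 'g::{finite, ab_group_add} set"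
  assumes n: "CARD('g) = n" and m: "m \<ge> 2" and lam: "lam > 0"
    and a: "a = (\<Sum>i=1..m. K i)"
    and card: "\<And>i. i \<in> {1..m} \<Longrightarrow> card (B i) = K i"
    and ne: "\<And>i. i \<in> {1..m} \<Longrightarrow> B i \<noteq> {}"
    and disj: "disjoint_family_on B {1..m}"
  shows "weak_AMD_code n m a (real lam / (real (Lcm (K ` {1..m})) * real m)) {1..m} B \<longleftrightarrow>
    BSWEDF n m K a lam B"
proof -
  let ?E = "external_differences m B"
  let ?U = "UNIV - {0 :: 'g}"
  define L where "L = real (Lcm (K ` {1..m})) * real m"
  have KL: "(\<lambda>j. card (B j)) ` {1..m} = K ` {1..m}"
    using card by (rule image_cong[OF refl])
  have "K i > 0" if "i \<in> {1..m}" for i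
    using card[OF that, symmetric] ne[OF that] by (simp add: card_gt_0_iff)
  then have "0 \<notin> K ` {1..m}"
    by fastforce
  then have Lcm: "0 < Lcm (K ` {1..m})"
    by (simp only: zero_less_iff_neq_zero Lcm_0_iff[OF finite_imageI[OF finite_atLeastAtMost]])
      simp
  with m have L: "L > 0"
    unfolding L_def by (intro mult_pos_pos) simp_all
  have cnt: "real (count ?E d) = L * adversary_success {1..m} B d" for d
    using count_external_differences_eq_adversary_success[OF disj ne, of d] m
    unfolding KL L_def by simp
  \<comment> \<open>Disjoint blocks never produce the difference 0, so inclusion only bounds the
    multiplicities of nonzero elements.\<close>
  have "count ?E 0 = 0"
    using disj by (auto simp: count_external_differences[OF disj] disjoint_family_on_def)
  then have sub: "?E \<subseteq># repeat_mset l (mset_set ?U) \<longleftrightarrow> (\<forall>d\<in>?U. count ?E d \<le> l)" for l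
    by (auto simp: subseteq_mset_def count_mset_set')
  \<comment> \<open>Here m \<ge> 2 enters: x - y is a nonzero external difference. It makes the
    maxima range over a nonempty set and, since shifting y by it reaches \<open>B 1\<close>, makes
    them positive.\<close>
  obtain x y where xy: "x \<in> B 1" "y \<in> B 2"
    using ne[of 1] ne[of 2] m by auto
  have "B 1 \<inter> B 2 = {}"
    using disj m by (intro disjoint_family_onD) auto
  with xy have d0: "x - y \<in> ?U"
    by auto
  then have U: "?U \<noteq> {}"
    by blast
  have "y \<in> {g \<in> B 2. g + (x - y) \<in> (\<Union>i\<in>{1..m} - {2}. B i)}"
    using xy m by (auto intro!: bexI[of _ 1])
  then have "0 < card {g \<in> B 2. g + (x - y) \<in> (\<Union>i\<in>{1..m} - {2}. B i)}"
    using finite unfolding card_gt_0_iff by blast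
  moreover have "0 < card (B 2)"
    using xy by (auto simp: card_gt_0_iff)
  ultimately have "0 < (\<Sum>j=1..m. 1 / real (card (B j)) *
      real (card {g \<in> B j. g + (x - y) \<in> (\<Union>i\<in>{1..m} - {j}. B i)}))"
    using m by (intro sum_pos2[of _ 2]) simp_all
  then have "adversary_success {1..m} B (x - y) > 0"
    using m ne by (subst adversary_success_eq) (auto simp del: sum_divide_distrib)
  then have pos: "0 < count ?E (x - y)"
    using cnt[of "x - y"] L by (simp flip: of_nat_0_less_iff [where 'a = real])
  have "real lam / L = Max (adversary_success {1..m} B ` ?U) \<longleftrightarrow>
      lam = Max (count ?E ` ?U)"
  proof -
    \<comment> \<open>\<open>Max\<close> commutes with monotone maps, here the embedding into the
      reals and multiplication by L > 0.\<close>
    have "real (Max (count ?E ` ?U)) = Max ((\<lambda>d. real (count ?E d)) ` ?U)"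
      using U by (subst mono_Max_commute) (auto simp: mono_def image_image)
    also have "\<dots> = Max ((\<lambda>r. L * r) ` adversary_success {1..m} B ` ?U)"
      by (simp add: cnt image_image)
    also have "\<dots> = L * Max (adversary_success {1..m} B ` ?U)"
      using U L by (subst mono_Max_commute[of "\<lambda>r. L * r"]) (auto simp: mono_def)
    finally have "lam = Max (count ?E ` ?U) \<longleftrightarrow> real lam = L * Max (adversary_success {1..m} B ` ?U)"
      by (metis of_nat_eq_iff)
    then show ?thesis
      using L by (auto simp: field_simps)
  qed
  also have "\<dots> \<longleftrightarrow> (\<forall>d\<in>?U. count ?E d \<le> lam) \<and> (\<forall>l>0. (\<forall>d\<in>?U. count ?E d \<le> l) \<longrightarrow> lam \<le> l)"
  proof -
    have le: "Max (count ?E ` ?U) \<le> l \<longleftrightarrow> (\<forall>d\<in>?U. count ?E d \<le> l)" for l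
      using U by (subst Max_le_iff) auto
    \<comment> \<open>Positivity makes the maximum itself an admissible l, so the least positive
      bound equals it.\<close>
    have "0 < Max (count ?E ` ?U)"
      using pos d0 U by (subst Max_gr_iff) auto
    then show ?thesis
      unfolding le[symmetric] by (auto intro: antisym)
  qed
  finally show ?thesis
    using n lam a ne disj card
    unfolding L_def by (simp add: weak_AMD_code_def BSWEDF_def sub)
qed

theorem theorem1:
  fixes n m a lam ktilde :: nat and K :: "nat \<Rightarrow> nat" and \<rho> :: real
  assumes "CARD('g::{finite, ab_group_add}) = n"
    and "m \<ge> 2"
    and "\<forall>i\<in>{1..m}. K i > 0"
    and "a = (\<Sum>i=1..m. K i)"
    and "ktilde = Lcm (K ` {1..m})"
    and "lam > 0"
    and "\<rho> = real lam / (real ktilde * real m)"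
  shows "(\<exists>(S :: 's::infinite set) (A :: 's \<Rightarrow> 'g set) (s :: nat \<Rightarrow> 's).
            weak_AMD_code n m a \<rho> S A \<and> bij_betw s {1..m} S \<and>
            (\<forall>i\<in>{1..m}. card (A (s i)) = K i))
         \<longleftrightarrow> (\<exists>B :: nat \<Rightarrow> 'g set. BSWEDF n m K a lam B)"
proof
  assume "\<exists>(S :: 's set) (A :: 's \<Rightarrow> 'g set) (s :: nat \<Rightarrow> 's).
            weak_AMD_code n m a \<rho> S A \<and> bij_betw s {1..m} S \<and>
            (\<forall>i\<in>{1..m}. card (A (s i)) = K i)"
  then obtain S :: "'s set" and A :: "'s \<Rightarrow> 'g set" and s :: "nat \<Rightarrow> 's"
    where "weak_AMD_code n m a \<rho> S A" and s: "bij_betw s {1..m} S"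
      and K: "\<forall>i\<in>{1..m}. card (A (s i)) = K i"
    by blast
  then have code: "weak_AMD_code n m a \<rho> {1..m} (A \<circ> s)"
    using assms(2) by (subst (asm) weak_AMD_code_reindex[OF s]) auto
  have "BSWEDF n m K a lam (A \<circ> s)"
    by (rule weak_AMD_code_iff_BSWEDF[THEN iffD1])
      (use assms K code in \<open>auto simp: weak_AMD_code_def\<close>)
  then show "\<exists>B :: nat \<Rightarrow> 'g set. BSWEDF n m K a lam B"
    by blast
next
  assume "\<exists>B :: nat \<Rightarrow> 'g set. BSWEDF n m K a lam B"
  then obtain B :: "nat \<Rightarrow> 'g set" where B: "BSWEDF n m K a lam B" ..
  have code: "weak_AMD_code n m a \<rho> {1..m} B"
    unfolding assms(5,7)
    by (rule weak_AMD_code_iff_BSWEDF[THEN iffD2])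
      (use assms B in \<open>auto simp: BSWEDF_def\<close>)
  \<comment> \<open>Injectivity on all of \<open>nat\<close> makes \<open>inv s\<close> a left
    inverse everywhere, so that \<open>A \<circ> s\<close> is literally \<open>B\<close>.\<close>
  obtain s :: "nat \<Rightarrow> 's" where s: "inj s"
    using infinite_countable_subset[OF infinite_UNIV] by blast
  define A where "A = B \<circ> inv s"
  have As: "A \<circ> s = B"
    using s by (simp add: A_def fun_eq_iff)
  have bij: "bij_betw s {1..m} (s ` {1..m})"
    using s by (simp add: bij_betw_def inj_on_def)
  have "weak_AMD_code n m a \<rho> (s ` {1..m}) A"
    using assms(2) code by (subst weak_AMD_code_reindex[OF bij]) (auto simp: As)
  moreover have "\<forall>i\<in>{1..m}. card (A (s i)) = K i"
    using B As by (auto simp: BSWEDF_def fun_eq_iff)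
  ultimately show "\<exists>(S :: 's set) (A :: 's \<Rightarrow> 'g set) (s :: nat \<Rightarrow> 's).
            weak_AMD_code n m a \<rho> S A \<and> bij_betw s {1..m} S \<and>
            (\<forall>i\<in>{1..m}. card (A (s i)) = K i)"
    using bij by blast
qed

end
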